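(* Let $\gamma$ be a smooth closed planar curve with strictly positive curvature bounding a convex region, let $M$ be its area evolute and $N$ the $v$-involute of $M$ (see context). Then $N$ is contained in the region $\overline{M}$ bounded by $M$, i.e. $N(\theta)\in\overline{M}$ for every $\theta$.
   Context: $[w_1,w_2]$ denotes the determinant of the $2\times 2$ matrix with columns $w_1,w_2\in\mathbb{R}^2$, and $e_\theta=(-\sin\theta,\cos\theta)$. The curve $\gamma$ is parameterized by $\theta$ ($2\pi$-periodically) so that $\gamma'(\theta)$ is a positive multiple of $e_\theta$. Put $M(\theta)=\frac12(\gamma(\theta)+\gamma(\theta+\pi))$ (the area evolute of $\gamma$). Fix $k>0$ and put $u(\theta)=\frac{k}{2}(\gamma(\theta)-\gamma(\theta+\pi))$; $u$ is a smooth convex curve, symmetric about the origin ($u(\theta+\pi)=-u(\theta)$), with strictly positive curvature, and $u'(\theta)$ is a positive multiple of $e_\theta$. Put $v(\theta)=u'(\theta)/[u(\theta),u'(\theta)]$; $v$ is also a smooth convex origin-symmetric curve, $[u,v]=1$ and $u=-v'/[v,v']$. The function $\alpha$ is defined by $M'(\theta)=\alpha(\theta)u'(\theta)$. Put $$\beta(\theta)=\tfrac12\int_\theta^{\theta+\pi}\alpha(s)[u,u'](s)\,ds,\qquad N(\theta)=M(\theta)+\beta(\theta)v(\theta).$$ The exterior of $M$ is the set of points of the plane that can be reached from a point of $\gamma$ by a (continuous) path that does not meet the image of $M$. The region $\overline{M}$ bounded by $M$ is the complement in $\mathbb{R}^2$ of the exterior of $M$. *)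

theory Defs
  imports "HOL-Analysis.Analysis"
begin

abbreviation vderiv :: "(real \<Rightarrow> real^2) \<Rightarrow> real \<Rightarrow> real^2" where
  "vderiv f \<equiv> \<lambda>t. vector_derivative f (at t)"

text \<open>\<open>C\<^sup>\<infinity>\<close>: every iterated derivative is differentiable everywhere.\<close>

definition smooth_curve :: "(real \<Rightarrow> real^2) \<Rightarrow> bool" where
  "smooth_curve f \<longleftrightarrow> (\<forall>n t. (vderiv ^^ n) f differentiable (at t))"

definition bracket :: "real^2 \<Rightarrow> real^2 \<Rightarrow> real" where
  "bracket w1 w2 = det (transpose (vector [w1, w2] :: real^2^2))"

definition e_dir :: "real \<Rightarrow> real^2" where
  "e_dir \<theta> = vector [- sin \<theta>, cos \<theta>]"

definition curvature :: "(real \<Rightarrow> real^2) \<Rightarrow> real \<Rightarrow> real" where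
  "curvature f t = bracket (vderiv f t) (vderiv (vderiv f) t) / norm (vderiv f t) ^ 3"

definition area_evolute :: "(real \<Rightarrow> real^2) \<Rightarrow> real \<Rightarrow> real^2" where
  "area_evolute \<gamma> \<theta> = (1/2) *\<^sub>R (\<gamma> \<theta> + \<gamma> (\<theta> + pi))"

definition sym_curve :: "real \<Rightarrow> (real \<Rightarrow> real^2) \<Rightarrow> real \<Rightarrow> real^2" where
  "sym_curve k \<gamma> \<theta> = (k/2) *\<^sub>R (\<gamma> \<theta> - \<gamma> (\<theta> + pi))"

definition dual_curve :: "(real \<Rightarrow> real^2) \<Rightarrow> real \<Rightarrow> real^2" where
  "dual_curve u \<theta> = (1 / bracket (u \<theta>) (vderiv u \<theta>)) *\<^sub>R vderiv u \<theta>"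

text \<open>The function \<open>\<alpha>\<close> with \<open>M' = \<alpha> u'\<close>; see \<open>ex1_rel_speed\<close> below for its well-definedness.\<close>

definition rel_speed :: "(real \<Rightarrow> real^2) \<Rightarrow> (real \<Rightarrow> real^2) \<Rightarrow> real \<Rightarrow> real" where
  "rel_speed M u \<theta> = (THE a. vderiv M \<theta> = a *\<^sub>R vderiv u \<theta>)"

definition involute_coeff :: "(real \<Rightarrow> real^2) \<Rightarrow> (real \<Rightarrow> real^2) \<Rightarrow> real \<Rightarrow> real" where
  "involute_coeff M u \<theta> =
     (1/2) * integral {\<theta>..\<theta> + pi} (\<lambda>s. rel_speed M u s * bracket (u s) (vderiv u s))"

definition v_involute :: "(real \<Rightarrow> real^2) \<Rightarrow> (real \<Rightarrow> real^2) \<Rightarrow> real \<Rightarrow> real^2" where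
  "v_involute M u \<theta> = M \<theta> + involute_coeff M u \<theta> *\<^sub>R dual_curve u \<theta>"

definition exterior_of :: "(real \<Rightarrow> real^2) \<Rightarrow> (real \<Rightarrow> real^2) \<Rightarrow> (real^2) set" where
  "exterior_of \<gamma> M = {p. \<exists>\<theta>. path_component (- range M) (\<gamma> \<theta>) p}"

definition region_bounded_by :: "(real \<Rightarrow> real^2) \<Rightarrow> (real \<Rightarrow> real^2) \<Rightarrow> (real^2) set" where
  "region_bounded_by \<gamma> M = - exterior_of \<gamma> M"

lemma bracket_eq: "bracket w1 w2 = w1$1 * w2$2 - w2$1 * w1$2"
  by (simp add: bracket_def det_2 transpose_def vector_2)

lemma ex1_rel_speed:
  assumes "smooth_curve \<gamma>" and "k > 0"
    and "\<And>\<theta>. \<exists>r>0. vderiv \<gamma> \<theta> = r *\<^sub>R e_dir \<theta>"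
  shows "\<exists>!a. vderiv (area_evolute \<gamma>) \<theta> = a *\<^sub>R vderiv (sym_curve k \<gamma>) \<theta>"
proof -
  have d: "(\<gamma> has_vector_derivative vderiv \<gamma> t) (at t)" for t
  proof -
    have "(vderiv ^^ 0) \<gamma> differentiable (at t)"
      using assms(1) unfolding smooth_curve_def by blast
    then show ?thesis by (simp add: vector_derivative_works)
  qed
  obtain r where r: "r > 0" "vderiv \<gamma> \<theta> = r *\<^sub>R e_dir \<theta>" using assms(3) by blast
  obtain s where s: "s > 0" "vderiv \<gamma> (\<theta> + pi) = s *\<^sub>R e_dir (\<theta> + pi)" using assms(3) by blast
  have e: "e_dir (\<theta> + pi) = - e_dir \<theta>"
    by (simp add: e_dir_def vec_eq_iff forall_2 vector_2)
  have d': "((\<lambda>t. \<gamma> (t + pi)) has_vector_derivative (- s) *\<^sub>R e_dir \<theta>) (at \<theta>)"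
  proof -
    have "((\<lambda>t. t + pi) has_vector_derivative 1) (at \<theta>)"
      by (auto intro!: derivative_eq_intros)
    from vector_diff_chain_at[OF this, of \<gamma> "vderiv \<gamma> (\<theta> + pi)"] d[of "\<theta> + pi"]
    show ?thesis using s e by (simp add: o_def)
  qed
  have M: "vderiv (area_evolute \<gamma>) \<theta> = ((r - s) / 2) *\<^sub>R e_dir \<theta>"
    unfolding area_evolute_def
    by (rule vector_derivative_at)
       (use d[of \<theta>] d' r in \<open>auto intro!: derivative_eq_intros simp: algebra_simps diff_divide_distrib\<close>)
  have U: "vderiv (sym_curve k \<gamma>) \<theta> = (k * (r + s) / 2) *\<^sub>R e_dir \<theta>"
    unfolding sym_curve_def
    by (rule vector_derivative_at)
       (use d[of \<theta>] d' r in \<open>auto intro!: derivative_eq_intros simp: algebra_simps add_divide_distrib\<close>)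
  have "e_dir \<theta> \<noteq> 0"
    by (auto simp: e_dir_def vec_eq_iff forall_2 vector_2 dest: sin_zero_abs_cos_one)
  moreover have "k * (r + s) / 2 \<noteq> 0" using r s assms(2) by auto
  ultimately show ?thesis unfolding M U
    by (intro ex1I[of _ "((r - s) / 2) / (k * (r + s) / 2)"]) (auto simp: field_simps)
qed

end

theory Submission
  imports Defs
begin

text \<open>
  Count the tangent lines of \<open>M\<close> through a point \<open>p\<close>, that is, the zeros of
  \<open>[p - M(\<theta>), e\<^sub>\<theta>]\<close> in a half-open interval of length \<open>\<pi>\<close>. As \<open>M'\<close> is parallel to
  \<open>e\<^sub>\<theta>\<close>, all zeros are simple unless \<open>p\<close> lies on \<open>M\<close>, so having at least two zeros is an open and
  closed condition on the complement of \<open>M\<close>. For \<open>p\<close> on \<open>\<gamma>\<close> there is only one zero, because \<open>p\<close>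
  lies strictly on one side of the chord from \<open>\<gamma>(\<theta> + \<pi>)\<close> to \<open>\<gamma>(\<theta>)\<close>; hence there is at most
  one throughout the exterior. For \<open>p = N(\<theta>)\<close> there is a zero at \<open>\<theta>\<close>, and the choice of
  \<open>\<beta>\<close> makes the integral of \<open>[p - M, u']\<close> over \<open>[\<theta>, \<theta> + \<pi>]\<close> vanish, which forces another
  zero in the interior of this interval.
\<close>

section \<open>The determinant form and the rotating frame\<close>

lemma bounded_bilinear_bracket: "bounded_bilinear bracket"
proof
  show "\<exists>K. \<forall>a b. norm (bracket a b) \<le> norm a * norm b * K"
  proof (intro exI[of _ 2] allI)
    fix a b :: "real^2"
    have "\<bar>a$i * b$j\<bar> \<le> norm a * norm b" for i j
      unfolding abs_mult by (intro mult_mono component_le_norm_cart) auto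
    from this[of 1 2] this[of 2 1] show "norm (bracket a b) \<le> norm a * norm b * 2"
      by (simp add: bracket_eq mult.commute[of "b$1"])
  qed
qed (simp_all add: bracket_eq algebra_simps)

interpretation bracket: bounded_bilinear bracket
  by (rule bounded_bilinear_bracket)

lemma bracket_self [simp]: "bracket a a = 0"
  by (simp add: bracket_eq)

lemma bracket_commute: "bracket a b = - bracket b a"
  by (simp add: bracket_eq)

lemma has_real_derivative_bracket:
  assumes "(f has_vector_derivative f') (at t within S)"
    and "(g has_vector_derivative g') (at t within S)"
  shows "((\<lambda>t. bracket (f t) (g t)) has_real_derivative bracket (f t) g' + bracket f' (g t))
           (at t within S)"
  using bracket.has_vector_derivative[OF assms]
  by (simp add: has_real_derivative_iff_has_vector_derivative)

lemma has_real_derivative_bracket_right: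
  assumes "(f has_vector_derivative f') (at t within S)"
  shows "((\<lambda>t. bracket a (f t)) has_real_derivative bracket a f') (at t within S)"
  using has_real_derivative_bracket[OF has_vector_derivative_const assms]
  by (simp add: bracket.zero_left)

lemma has_real_derivative_bracket_left:
  assumes "(f has_vector_derivative f') (at t within S)"
  shows "((\<lambda>t. bracket (f t) a) has_real_derivative bracket f' a) (at t within S)"
  using has_real_derivative_bracket[OF assms has_vector_derivative_const]
  by (simp add: bracket.zero_right)

text \<open>The outward unit normal at angle \<theta>; followed by \<open>e_dir\<close> it forms a
  positively oriented orthonormal frame.\<close>

definition n_dir :: "real \<Rightarrow> real^2" where
  "n_dir \<theta> = vector [cos \<theta>, sin \<theta>]"

lemma bracket_n_dir_e_dir: "bracket (n_dir \<theta>) (e_dir \<theta>) = 1"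
  by (simp add: bracket_eq n_dir_def e_dir_def flip: power2_eq_square)

lemma bracket_e_dir_e_dir: "bracket (e_dir s) (e_dir t) = sin (t - s)"
  by (simp add: bracket_eq e_dir_def sin_diff)

lemma e_dir_add_pi [simp]: "e_dir (\<theta> + pi) = - e_dir \<theta>"
  by (simp add: e_dir_def vec_eq_iff forall_2 vector_2)

lemma e_dir_neq_0: "e_dir \<theta> \<noteq> 0"
  using bracket_n_dir_e_dir[of \<theta>] by (auto simp: bracket.zero_right)

lemma e_dir_has_vector_derivative:
  "(e_dir has_vector_derivative - n_dir \<theta>) (at \<theta> within S)"
proof -
  have e: "e_dir = (\<lambda>t. (- sin t) *\<^sub>R axis 1 1 + cos t *\<^sub>R axis 2 1)"
    by (simp add: fun_eq_iff e_dir_def vec_eq_iff forall_2 axis_def)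
  have "- n_dir \<theta> = (- cos \<theta>) *\<^sub>R axis 1 1 + (- sin \<theta>) *\<^sub>R axis 2 1"
    by (simp add: n_dir_def vec_eq_iff forall_2 axis_def)
  then show ?thesis
    unfolding e
    by (auto intro!: derivative_eq_intros
        simp: has_real_derivative_iff_has_vector_derivative[symmetric])
qed

lemma continuous_on_n_dir: "continuous_on S n_dir"
proof -
  have n: "n_dir = (\<lambda>t. cos t *\<^sub>R axis 1 1 + sin t *\<^sub>R axis 2 1)"
    by (simp add: fun_eq_iff n_dir_def vec_eq_iff forall_2 axis_def)
  show ?thesis unfolding n by (intro continuous_intros)
qed

lemma bracket_dirs_eq_0_imp:
  assumes "bracket a (e_dir \<theta>) = 0" "bracket a (n_dir \<theta>) = 0"
  shows "a = 0"
proof -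
  have "a$1 * cos \<theta> + a$2 * sin \<theta> = 0" "a$1 * sin \<theta> - a$2 * cos \<theta> = 0"
    using assms by (simp_all add: bracket_eq e_dir_def n_dir_def algebra_simps)
  then have "(a$1)\<^sup>2 * ((cos \<theta>)\<^sup>2 + (sin \<theta>)\<^sup>2) + (a$2)\<^sup>2 * ((cos \<theta>)\<^sup>2 + (sin \<theta>)\<^sup>2) = 0"
    by algebra
  then show ?thesis
    by (auto simp: vec_eq_iff forall_2 add_nonneg_eq_0_iff)
qed

text \<open>The Pluecker relation of the plane. With \<open>n\<close>, \<open>e\<close> the moving
  frame it collapses the quotient-rule numerator in \<open>not_multi_tangent_curve\<close> to a
  single bracket.\<close>

lemma bracket_pluecker:
  "bracket a n * bracket u e - bracket a e * bracket u n = bracket a u * bracket n e"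
  by (simp add: bracket_eq algebra_simps)

section \<open>Convexity of a closed curve parameterized by its tangent angle\<close>

locale tangent_angle_curve =
  fixes \<gamma> :: "real \<Rightarrow> real^2" and r :: "real \<Rightarrow> real"
  assumes deriv: "(\<gamma> has_vector_derivative r \<theta> *\<^sub>R e_dir \<theta>) (at \<theta>)"
    and r_pos: "r \<theta> > 0"
    and continuous_r: "continuous_on UNIV r"
    and closed: "\<gamma> (\<theta> + 2 * pi) = \<gamma> \<theta>"
begin

text \<open>Moving the endpoint \<open>\<gamma> s\<close> of the chord changes the bracket at rate
  \<open>r s * sin (y - s)\<close>, and the angle bounds keep \<open>y - s\<close> strictly between
  0 and \<pi>.\<close>

lemma bracket_chord_e_dir_pos:
  assumes "x < t" "t \<le> y" "y \<le> x + pi"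
  shows "bracket (\<gamma> t - \<gamma> x) (e_dir y) > 0"
proof -
  have d: "((\<lambda>t. bracket (\<gamma> t) (e_dir y)) has_real_derivative r s * sin (y - s)) (at s within S)"
    for s S
    using has_real_derivative_bracket_left[OF
        has_vector_derivative_at_within[OF deriv[of s]], of "e_dir y" S]
    by (simp add: bracket.scaleR_left bracket_e_dir_e_dir)
  have "bracket (\<gamma> x) (e_dir y) < bracket (\<gamma> t) (e_dir y)"
  proof (rule DERIV_pos_imp_increasing_open[OF \<open>x < t\<close>])
    fix s assume "x < s" "s < t"
    then have "r s * sin (y - s) > 0"
      using assms r_pos by (intro mult_pos_pos sin_gt_zero) auto
    then show "\<exists>l. ((\<lambda>t. bracket (\<gamma> t) (e_dir y)) has_real_derivative l) (at s) \<and> l > 0"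
      using d by blast
  qed (rule DERIV_continuous_on[OF d])
  then show ?thesis by (simp add: bracket.diff_left)
qed

text \<open>Integrating the previous inequality from \<open>t\<close> to \<open>y\<close>: points
  whose angles span at most a half turn form a positively oriented triangle.\<close>

lemma bracket_chords_pos:
  assumes "x < t" "t < y" "y \<le> x + pi"
  shows "bracket (\<gamma> t - \<gamma> x) (\<gamma> y - \<gamma> t) > 0"
proof -
  let ?f = "\<lambda>s. bracket (\<gamma> t - \<gamma> x) (\<gamma> s)"
  have d: "(?f has_real_derivative r s * bracket (\<gamma> t - \<gamma> x) (e_dir s)) (at s within S)" for s S
    using has_real_derivative_bracket_right[OF has_vector_derivative_at_within[OF deriv[of s]]]
    by (simp add: bracket.scaleR_right)
  have "?f t < ?f y"
  proof (rule DERIV_pos_imp_increasing_open[OF \<open>t < y\<close>])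
    fix s assume "t < s" "s < y"
    then have "r s * bracket (\<gamma> t - \<gamma> x) (e_dir s) > 0"
      using assms r_pos by (intro mult_pos_pos bracket_chord_e_dir_pos) auto
    then show "\<exists>l. (?f has_real_derivative l) (at s) \<and> l > 0"
      using d by blast
  qed (rule DERIV_continuous_on[OF d])
  then show ?thesis by (simp add: bracket.diff_right)
qed

lemma deriv_add_pi:
  "((\<lambda>t. \<gamma> (t + pi)) has_vector_derivative - (r (\<theta> + pi) *\<^sub>R e_dir \<theta>)) (at \<theta>)"
proof -
  have "((\<lambda>t. t + pi) has_vector_derivative 1) (at \<theta>)"
    by (auto intro!: derivative_eq_intros)
  from vector_diff_chain_at[OF this, of \<gamma> "r (\<theta> + pi) *\<^sub>R e_dir (\<theta> + pi)"] deriv[of "\<theta> + pi"]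
  show ?thesis by (simp add: o_def)
qed

lemma curve_add_pi: "\<gamma> (\<theta> + pi) = \<gamma> (\<theta> - pi)"
  using closed[of "\<theta> - pi"] by (simp add: algebra_simps)

abbreviation M where "M \<equiv> area_evolute \<gamma>"

lemma area_evolute_add_pi [simp]: "M (\<theta> + pi) = M \<theta>"
  using closed[of \<theta>] by (simp add: area_evolute_def algebra_simps)

lemma sym_curve_add_pi [simp]: "sym_curve k \<gamma> (\<theta> + pi) = - sym_curve k \<gamma> \<theta>"
  using closed[of \<theta>] by (simp add: sym_curve_def algebra_simps)

lemma area_evolute_deriv:
  "(M has_vector_derivative ((r \<theta> - r (\<theta> + pi)) / 2) *\<^sub>R e_dir \<theta>) (at \<theta>)"
  unfolding area_evolute_def[abs_def]
  by (rule has_vector_derivative_eq_rhs,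
      rule has_vector_derivative_scaleR[OF DERIV_const has_vector_derivative_add[OF deriv deriv_add_pi]])
     (simp add: algebra_simps diff_divide_distrib)

lemma sym_curve_deriv:
  "(sym_curve k \<gamma> has_vector_derivative (k * (r \<theta> + r (\<theta> + pi)) / 2) *\<^sub>R e_dir \<theta>) (at \<theta>)"
  unfolding sym_curve_def[abs_def]
  by (rule has_vector_derivative_eq_rhs,
      rule has_vector_derivative_scaleR[OF DERIV_const has_vector_derivative_diff[OF deriv deriv_add_pi]])
     (simp add: algebra_simps add_divide_distrib)

lemma bracket_sym_curve_e_dir_pos:
  assumes "k > 0"
  shows "bracket (sym_curve k \<gamma> \<theta>) (e_dir \<theta>) > 0"
  using bracket_chord_e_dir_pos[of "\<theta> - pi" \<theta> \<theta>] assms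
  by (simp add: sym_curve_def curve_add_pi bracket.scaleR_left)

text \<open>\<open>M \<theta>\<close> is the midpoint of the chord from
  \<open>\<gamma> (\<theta> - pi)\<close> to \<open>\<gamma> \<theta>\<close>, and
  \<open>\<gamma> \<tau>\<close> lies on the open arc between these endpoints, hence strictly on one
  side of the chord.\<close>

lemma bracket_curve_area_evolute_pos:
  assumes "k > 0" "\<tau> < \<theta>" "\<theta> < \<tau> + pi"
  shows "bracket (\<gamma> \<tau> - M \<theta>) (sym_curve k \<gamma> \<theta>) > 0"
proof -
  \<comment> \<open>For chord endpoints A, B and a point P: [P - (A+B)/2, B - A] = [P - A, B - A] =
    [P - A, B - P].\<close>
  have "bracket (\<gamma> \<tau> - M \<theta>) (sym_curve k \<gamma> \<theta>)
      = k / 2 * bracket (\<gamma> \<tau> - \<gamma> (\<theta> - pi)) (\<gamma> \<theta> - \<gamma> \<tau>)"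
    unfolding area_evolute_def sym_curve_def curve_add_pi by (simp add: bracket_eq field_simps)
  also have "\<dots> > 0"
    using bracket_chords_pos[of "\<theta> - pi" \<tau> \<theta>] assms by (intro mult_pos_pos) auto
  finally show ?thesis .
qed

section \<open>Tangent lines of the area evolute through a point\<close>

definition side :: "real^2 \<Rightarrow> real \<Rightarrow> real" where
  "side p \<theta> = bracket (p - M \<theta>) (e_dir \<theta>)"

text \<open>The motion of \<open>M\<close> is parallel to \<open>e_dir\<close> and contributes
  nothing; only the rotation of \<open>e_dir\<close> does.\<close>

lemma side_deriv: "(side p has_real_derivative - bracket (p - M \<theta>) (n_dir \<theta>)) (at \<theta> within S)"
proof -
  have "((\<lambda>t. p - M t) has_vector_derivative 0 - ((r \<theta> - r (\<theta> + pi)) / 2) *\<^sub>R e_dir \<theta>) (at \<theta>)"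
    by (intro has_vector_derivative_diff has_vector_derivative_const area_evolute_deriv)
  from has_real_derivative_bracket[OF this e_dir_has_vector_derivative] show ?thesis
    unfolding side_def[abs_def]
    by - (rule has_field_derivative_at_within, simp add: bracket.scaleR_left bracket.minus_left bracket.minus_right)
qed

lemma side_add_pi: "side p (\<theta> + pi) = - side p \<theta>"
  by (simp add: side_def bracket.minus_right)

lemma side_add_int_pi_eq_0_iff: "side p (\<theta> + of_int m * pi) = 0 \<longleftrightarrow> side p \<theta> = 0"
proof (induction m rule: int_induct[of _ 0])
  case (step1 i)
  then show ?case using side_add_pi[of p "\<theta> + of_int i * pi"] by (simp add: algebra_simps)
next
  case (step2 i)
  then show ?case using side_add_pi[of p "\<theta> + of_int (i - 1) * pi"] by (simp add: algebra_simps)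
qed simp

text \<open>Using \<open>side\<close> instead of the direction of M' keeps a tangent line at cusps,
  where M' vanishes. The strict bound \<open>b < a + pi\<close> avoids counting one line twice,
  since \<open>a\<close> and \<open>a + pi\<close> give the same line.\<close>

definition multi_tangent :: "real^2 \<Rightarrow> bool" where
  "multi_tangent p \<longleftrightarrow> (\<exists>a b. a < b \<and> b < a + pi \<and> side p a = 0 \<and> side p b = 0)"

text \<open>Zeros of \<open>side p\<close> recur with period \<pi>, so the pair can be translated
  until \<open>a\<close> lies in a prescribed window.\<close>

lemma multi_tangentE:
  assumes "multi_tangent p"
  obtains a b where "t \<le> a" "a < t + pi" "a < b" "b < a + pi" "side p a = 0" "side p b = 0"
proof -
  obtain a b where ab: "a < b" "b < a + pi" "side p a = 0" "side p b = 0"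
    using assms unfolding multi_tangent_def by blast
  define m where "m = - \<lfloor>(a - t) / pi\<rfloor>"
  have "of_int (- m) \<le> (a - t) / pi" "(a - t) / pi < of_int (- m) + 1"
    unfolding m_def by (simp_all add: floor_correct)
  then have "t \<le> a + of_int m * pi" "a + of_int m * pi < t + pi"
    by (simp_all add: field_simps)
  then show thesis
    using that[of "a + of_int m * pi" "b + of_int m * pi"] ab by (simp add: side_add_int_pi_eq_0_iff)
qed

text \<open>The derivative of [\<gamma>(\<tau>) - M, v] is a negative multiple of the chord bracket,
  which is positive strictly between \<tau> and \<tau> + \<pi>. So this function is strictly
  decreasing on the closed half turn and vanishes there at most once.\<close>

lemma not_multi_tangent_curve: "\<not> multi_tangent (\<gamma> \<tau>)"
proof
  assume "multi_tangent (\<gamma> \<tau>)"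
  then obtain a b where ab: "\<tau> \<le> a" "a < \<tau> + pi" "a < b" "b < a + pi"
    "side (\<gamma> \<tau>) a = 0" "side (\<gamma> \<tau>) b = 0"
    by (rule multi_tangentE)
  \<comment> \<open>The tangent lines of \<open>M\<close> do not see the scale of \<open>u\<close>,
    so the scale 1 is chosen.\<close>
  define u where "u = sym_curve 1 \<gamma>"
  define w where "w = (\<lambda>\<theta>. bracket (u \<theta>) (e_dir \<theta>))"
  \<comment> \<open>\<open>G\<close> is \<open>[p - M, v]\<close>; dividing by \<open>w\<close> instead of using \<open>v\<close> avoids second derivatives.\<close>
  define G where "G = (\<lambda>\<theta>. side (\<gamma> \<tau>) \<theta> / w \<theta>)"
  have w: "w \<theta> > 0" for \<theta>
    by (simp add: w_def u_def bracket_sym_curve_e_dir_pos)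
  have w': "(w has_real_derivative - bracket (u \<theta>) (n_dir \<theta>)) (at \<theta> within S)" for \<theta> S
    using has_real_derivative_bracket[OF sym_curve_deriv[of 1] e_dir_has_vector_derivative]
    unfolding w_def u_def
    by - (rule has_field_derivative_at_within, simp add: bracket.scaleR_left bracket.minus_right)
  have G': "(G has_real_derivative - bracket (\<gamma> \<tau> - M \<theta>) (u \<theta>) / (w \<theta>)\<^sup>2) (at \<theta> within S)" for \<theta> S
  proof -
    have "- bracket (\<gamma> \<tau> - M \<theta>) (n_dir \<theta>) * w \<theta> - side (\<gamma> \<tau>) \<theta> * - bracket (u \<theta>) (n_dir \<theta>)
        = - bracket (\<gamma> \<tau> - M \<theta>) (u \<theta>)"
      using bracket_pluecker[of "\<gamma> \<tau> - M \<theta>" "n_dir \<theta>" "u \<theta>" "e_dir \<theta>"]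
      by (simp add: w_def side_def bracket_n_dir_e_dir)
    with DERIV_divide[OF side_deriv[of "\<gamma> \<tau>" \<theta> S] w'[of \<theta> S]] w[of \<theta>] show ?thesis
      unfolding G_def by (simp add: power2_eq_square)
  qed
  have "G y < G x" if "\<tau> \<le> x" "x < y" "y \<le> \<tau> + pi" for x y
  proof (rule DERIV_neg_imp_decreasing_open[OF \<open>x < y\<close>])
    fix \<theta> assume "x < \<theta>" "\<theta> < y"
    then have "- bracket (\<gamma> \<tau> - M \<theta>) (u \<theta>) / (w \<theta>)\<^sup>2 < 0"
      using bracket_curve_area_evolute_pos[of 1 \<tau> \<theta>] w[of \<theta>] that
      by (simp add: u_def divide_neg_pos)
    then show "\<exists>l. (G has_real_derivative l) (at \<theta>) \<and> l < 0"
      using G' by blast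
  qed (rule DERIV_continuous_on[OF G'])
  note G_decreasing = this
  have G: "G a = 0" "G b = 0" "G (b - pi) = 0"
    using ab side_add_pi[of "\<gamma> \<tau>" "b - pi"] by (simp_all add: G_def)
  show False
  \<comment> \<open>Either both zeros lie in the half turn, or \<open>b\<close> overshoots it and
    \<open>b - pi\<close> lies between \<tau> and \<open>a\<close>.\<close>
  proof (cases "b \<le> \<tau> + pi")
    case True
    then show False using G_decreasing[of a b] ab G by simp
  next
    case False
    then show False using G_decreasing[of "b - pi" a] ab G by simp
  qed
qed

section \<open>Stability of the tangent count off the evolute\<close>

lemma tendsto_side:
  assumes "x \<longlonglongrightarrow> p" "s \<longlonglongrightarrow> \<theta>"
  shows "(\<lambda>n. side (x n) (s n)) \<longlonglongrightarrow> side p \<theta>"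
    and "(\<lambda>n. bracket (x n - M (s n)) (n_dir (s n))) \<longlonglongrightarrow> bracket (p - M \<theta>) (n_dir \<theta>)"
proof -
  have "isCont M \<theta>" "isCont e_dir \<theta>" "isCont n_dir \<theta>"
    using has_vector_derivative_continuous[OF area_evolute_deriv]
      has_vector_derivative_continuous[OF e_dir_has_vector_derivative]
      continuous_on_n_dir[of UNIV] by (simp_all add: continuous_on_eq_continuous_at)
  note [tendsto_intros] = this[THEN isCont_tendsto_compose, OF assms(2)] assms(1) bracket.tendsto
  show "(\<lambda>n. side (x n) (s n)) \<longlonglongrightarrow> side p \<theta>"
    unfolding side_def by (intro tendsto_intros)
  show "(\<lambda>n. bracket (x n - M (s n)) (n_dir (s n))) \<longlonglongrightarrow> bracket (p - M \<theta>) (n_dir \<theta>)"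
    by (intro tendsto_intros)
qed

text \<open>Since \<open>M'\<close> is parallel to \<open>e_dir\<close>, a multiple zero of \<open>side p\<close> forces \<open>p\<close> onto \<open>M\<close>.\<close>

lemma collapsing_zeros_imp_on_area_evolute:
  assumes "x \<longlonglongrightarrow> p" "a \<longlonglongrightarrow> \<theta>" "b \<longlonglongrightarrow> \<theta>"
    and "\<And>n. a n < b n" "\<And>n. side (x n) (a n) = 0" "\<And>n. side (x n) (b n) = 0"
  shows "p \<in> range M"
proof -
  \<comment> \<open>Rolle gives a critical point between the two zeros; in the limit both the value
    and the derivative of \<open>side p\<close> vanish at \<theta>.\<close>
  have "\<exists>\<xi>. a n < \<xi> \<and> \<xi> < b n \<and> bracket (x n - M \<xi>) (n_dir \<xi>) = 0" for n
  proof -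
    have "side (x n) (b n) - side (x n) (a n) = 0"
      using assms by simp
    with MVT2[OF assms(4)[of n] side_deriv[of "x n"]] assms(4)[of n] show ?thesis by auto
  qed
  then obtain \<xi> where \<xi>: "\<And>n. a n < \<xi> n" "\<And>n. \<xi> n < b n"
    "\<And>n. bracket (x n - M (\<xi> n)) (n_dir (\<xi> n)) = 0"
    by metis
  have "\<xi> \<longlonglongrightarrow> \<theta>"
    by (rule tendsto_sandwich[OF _ _ assms(2,3)]) (simp_all add: less_imp_le \<xi>(1,2))
  from tendsto_side(2)[OF assms(1) this] \<xi>(3) have "bracket (p - M \<theta>) (n_dir \<theta>) = 0"
    by (simp add: LIMSEQ_const_iff)
  moreover from tendsto_side(1)[OF assms(1,2)] assms(5) have "side p \<theta> = 0"
    by (simp add: LIMSEQ_const_iff)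
  ultimately have "p - M \<theta> = 0"
    unfolding side_def by (intro bracket_dirs_eq_0_imp)
  then show ?thesis by auto
qed

text \<open>By compactness a subsequence of the pairs of zeros converges. Its limit satisfies only
  weak inequalities, but a collision at either end would put \<open>p\<close> on
  \<open>M\<close>.\<close>

lemma multi_tangent_closure:
  assumes "p \<in> closure (Collect multi_tangent)" "p \<notin> range M"
  shows "multi_tangent p"
proof -
  obtain x where x: "\<And>n. multi_tangent (x n)" "x \<longlonglongrightarrow> p"
    using assms(1) unfolding closure_sequential by auto
  have "\<exists>a b. a \<in> {0..pi} \<and> b \<in> {0..2 * pi} \<and> a < b \<and> b < a + pi
      \<and> side (x n) a = 0 \<and> side (x n) b = 0" for n
  proof -
    obtain a b where "0 \<le> a" "a < 0 + pi" "a < b" "b < a + pi" "side (x n) a = 0" "side (x n) b = 0"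
      by (rule multi_tangentE[OF x(1)])
    then show ?thesis by (intro exI[of _ a] exI[of _ b]) auto
  qed
  then obtain a b where ab: "\<And>n. a n \<in> {0..pi}" "\<And>n. b n \<in> {0..2 * pi}" "\<And>n. a n < b n"
    "\<And>n. b n < a n + pi" "\<And>n. side (x n) (a n) = 0" "\<And>n. side (x n) (b n) = 0"
    by metis
  have "compact ({0..pi} \<times> {0..2 * pi})"
    by (intro compact_Times compact_Icc)
  then obtain l f where f: "strict_mono f" "((\<lambda>n. (a n, b n)) \<circ> f) \<longlonglongrightarrow> l"
    using ab(1,2) unfolding compact_def by (metis (no_types, lifting) mem_Sigma_iff)
  define \<alpha> where "\<alpha> = fst l"
  define \<beta> where "\<beta> = snd l"
  have a: "(\<lambda>n. a (f n)) \<longlonglongrightarrow> \<alpha>" and b: "(\<lambda>n. b (f n)) \<longlonglongrightarrow> \<beta>"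
    using tendsto_fst[OF f(2)] tendsto_snd[OF f(2)] by (simp_all add: o_def \<alpha>_def \<beta>_def)
  have x': "(\<lambda>n. x (f n)) \<longlonglongrightarrow> p"
    using LIMSEQ_subseq_LIMSEQ[OF x(2) f(1)] by (simp add: o_def)
  have api: "(\<lambda>n. a (f n) + pi) \<longlonglongrightarrow> \<alpha> + pi"
    by (intro tendsto_intros a)
  have "\<alpha> \<le> \<beta>"
    by (rule LIMSEQ_le[OF a b]) (use ab in \<open>auto intro!: less_imp_le\<close>)
  moreover have "\<beta> \<le> \<alpha> + pi"
    by (rule LIMSEQ_le[OF b api]) (use ab in \<open>auto intro!: less_imp_le\<close>)
  moreover have "\<alpha> \<noteq> \<beta>"
    using collapsing_zeros_imp_on_area_evolute[OF x' a] b ab assms(2) by blast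
  \<comment> \<open>Here the colliding zeros are \<open>b\<close> and the translate
    \<open>a + pi\<close>.\<close>
  moreover have "\<beta> \<noteq> \<alpha> + pi"
    using collapsing_zeros_imp_on_area_evolute[OF x', of "\<lambda>n. b (f n)" \<beta> "\<lambda>n. a (f n) + pi"] b api ab assms(2) by (auto simp: side_add_pi)
  moreover have "side p \<alpha> = 0" "side p \<beta> = 0"
    using tendsto_side(1)[OF x' a] tendsto_side(1)[OF x' b] ab
    by (simp_all add: LIMSEQ_const_iff)
  ultimately show ?thesis
    unfolding multi_tangent_def by (meson order_le_less)
qed

text \<open>Value and derivative of \<open>side p\<close> are, up to sign, the brackets of
  \<open>p - M \<theta>\<close> with a frame, so off \<open>M\<close> every zero is simple. The
  resulting sign change, unlike a mere zero, survives perturbing \<open>p\<close>.\<close>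

lemma side_sign_change:
  assumes "side p \<theta> = 0" "p \<notin> range M" "\<epsilon> > 0"
  obtains c d where "\<theta> - \<epsilon> < c" "c < d" "d < \<theta> + \<epsilon>" "side p c * side p d < 0"
proof -
  define l where "l = - bracket (p - M \<theta>) (n_dir \<theta>)"
  have d: "(side p has_real_derivative l) (at \<theta>)"
    unfolding l_def by (rule side_deriv)
  have "l \<noteq> 0"
    using assms(1,2) bracket_dirs_eq_0_imp[of "p - M \<theta>" \<theta>] by (auto simp: l_def side_def)
  then consider "l > 0" | "l < 0" by linarith
  then have "\<exists>h. 0 < h \<and> h < \<epsilon> \<and> side p (\<theta> - h) * side p (\<theta> + h) < 0"
  proof cases
    case 1
    obtain d1 where d1: "d1 > 0" "\<And>h. h > 0 \<Longrightarrow> h < d1 \<Longrightarrow> side p \<theta> < side p (\<theta> + h)"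
      using DERIV_pos_inc_right[OF d 1] by blast
    obtain d2 where d2: "d2 > 0" "\<And>h. h > 0 \<Longrightarrow> h < d2 \<Longrightarrow> side p (\<theta> - h) < side p \<theta>"
      using DERIV_pos_inc_left[OF d 1] by blast
    obtain h where "0 < h" "h < min \<epsilon> (min d1 d2)"
      using dense[of 0 "min \<epsilon> (min d1 d2)"] assms(3) d1(1) d2(1) by auto
    with d1(2)[of h] d2(2)[of h] assms(1) show ?thesis by (intro exI[of _ h]) (simp add: mult_neg_pos)
  next
    case 2
    obtain d1 where d1: "d1 > 0" "\<And>h. h > 0 \<Longrightarrow> h < d1 \<Longrightarrow> side p \<theta> > side p (\<theta> + h)"
      using DERIV_neg_dec_right[OF d 2] by blast
    obtain d2 where d2: "d2 > 0" "\<And>h. h > 0 \<Longrightarrow> h < d2 \<Longrightarrow> side p (\<theta> - h) > side p \<theta>"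
      using DERIV_neg_dec_left[OF d 2] by blast
    obtain h where "0 < h" "h < min \<epsilon> (min d1 d2)"
      using dense[of 0 "min \<epsilon> (min d1 d2)"] assms(3) d1(1) d2(1) by auto
    with d1(2)[of h] d2(2)[of h] assms(1) show ?thesis by (intro exI[of _ h]) (simp add: mult_pos_neg)
  qed
  then obtain h where "0 < h" "h < \<epsilon>" "side p (\<theta> - h) * side p (\<theta> + h) < 0" by blast
  then show thesis by (intro that[of "\<theta> - h" "\<theta> + h"]) simp_all
qed

lemma side_zero_between:
  assumes "c < d" "side p c * side p d < 0"
  obtains z where "c < z" "z < d" "side p z = 0"
proof -
  have c: "continuous_on {c..d} (side p)"
    by (rule DERIV_continuous_on[OF side_deriv])
  have "\<exists>z\<ge>c. z \<le> d \<and> side p z = 0"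
  proof (cases "side p c \<le> 0")
    case True
    then show ?thesis using IVT'[of "side p" c 0 d] c assms by (auto simp: mult_less_0_iff)
  next
    case False
    then show ?thesis using IVT2'[of "side p" d 0 c] c assms by (auto simp: mult_less_0_iff)
  qed
  then obtain z where z: "c \<le> z" "z \<le> d" "side p z = 0" by blast
  then have "z \<noteq> c" "z \<noteq> d" using assms(2) by auto
  then show thesis using that[of z] z by simp
qed

text \<open>Two sign changes at fixed angles are strict inequalities in \<open>p\<close>, hence
  persist nearby, where the intermediate value theorem turns them back into zeros.\<close>

lemma multi_tangent_interior:
  assumes "multi_tangent p" "p \<notin> range M"
  shows "p \<in> interior (Collect multi_tangent)"
proof -
  obtain a b where ab: "a < b" "b < a + pi" "side p a = 0" "side p b = 0"
    using assms(1) unfolding multi_tangent_def by blast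
  \<comment> \<open>Half the smaller gap makes the open \<epsilon>-intervals around
    \<open>a\<close>, \<open>b\<close> and \<open>a + pi\<close> disjoint, so the perturbed zeros
    stay ordered and less than \<pi> apart.\<close>
  define \<epsilon> where "\<epsilon> = min (b - a) (a + pi - b) / 2"
  have \<epsilon>: "\<epsilon> > 0" "a + \<epsilon> \<le> b - \<epsilon>" "b + \<epsilon> \<le> a - \<epsilon> + pi"
    using ab(1,2) by (auto simp: \<epsilon>_def min_def field_simps)
  obtain c d where cd: "a - \<epsilon> < c" "c < d" "d < a + \<epsilon>" "side p c * side p d < 0"
    by (rule side_sign_change[OF ab(3) assms(2) \<epsilon>(1)])
  obtain c' d' where cd': "b - \<epsilon> < c'" "c' < d'" "d' < b + \<epsilon>" "side p c' * side p d' < 0"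
    by (rule side_sign_change[OF ab(4) assms(2) \<epsilon>(1)])
  define U where "U = {q. side q c * side q d < 0} \<inter> {q. side q c' * side q d' < 0}"
  have "continuous_on UNIV (\<lambda>q. side q t)" for t
    unfolding side_def by (intro bracket.continuous_on continuous_intros)
  then have "open U"
    unfolding U_def by (intro open_Int open_Collect_less continuous_on_mult continuous_on_const)
  moreover have "p \<in> U"
    using cd cd' by (simp add: U_def)
  moreover have "U \<subseteq> Collect multi_tangent"
  proof
    fix q assume q: "q \<in> U"
    obtain z where z: "c < z" "z < d" "side q z = 0"
      using q side_zero_between[OF cd(2), of q] by (auto simp: U_def)
    obtain z' where z': "c' < z'" "z' < d'" "side q z' = 0"
      using q side_zero_between[OF cd'(2), of q] by (auto simp: U_def)
    have "z < z'" "z' < z + pi"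
      using z z' cd cd' \<epsilon> by linarith+
    then show "q \<in> Collect multi_tangent"
      using z z' unfolding multi_tangent_def by blast
  qed
  ultimately show ?thesis by (rule interiorI)
qed

section \<open>From the tangent count to the exterior\<close>

lemma multi_tangent_in_region:
  assumes "multi_tangent p"
  shows "p \<in> region_bounded_by \<gamma> M"
  unfolding region_bounded_by_def exterior_of_def
proof safe
  fix \<theta> assume "path_component (- range M) (\<gamma> \<theta>) p"
  then obtain T where T: "connected T" "T \<subseteq> - range M" "\<gamma> \<theta> \<in> T" "p \<in> T"
    using path_component_subset_connected_component[of "- range M" "\<gamma> \<theta>"]
    unfolding connected_component_def by blast
  \<comment> \<open>Off \<open>M\<close> the multiply tangent points form an open and closed set, so
    these two open sets cover \<open>T\<close>; one contains \<open>p\<close>, the other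
    \<open>\<gamma> \<theta>\<close>.\<close>
  let ?A = "interior (Collect multi_tangent)" and ?B = "- closure (Collect multi_tangent)"
  have "T \<subseteq> ?A \<union> ?B"
    using T(2) multi_tangent_closure multi_tangent_interior by blast
  moreover have "?A \<inter> ?B \<inter> T = {}"
    using interior_subset closure_subset by blast
  moreover have "p \<in> ?A \<inter> T" "\<gamma> \<theta> \<in> ?B \<inter> T"
    using T assms multi_tangent_interior multi_tangent_closure not_multi_tangent_curve by blast+
  ultimately show False
    using connectedD[OF T(1), of ?A ?B] by auto
qed

section \<open>Tangent lines through a point of the involute\<close>

lemma v_involute_multi_tangent:
  assumes "k > 0"
  shows "multi_tangent (v_involute M (sym_curve k \<gamma>) \<theta>)"
proof -
  define u where "u = sym_curve k \<gamma>"
  define \<mu> where "\<mu> = (\<lambda>t. (r t - r (t + pi)) / 2)"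
  define \<nu> where "\<nu> = (\<lambda>t. k * (r t + r (t + pi)) / 2)"
  define p where "p = v_involute M u \<theta>"
  \<comment> \<open>This is the integrand \<alpha>[u,u'] of \<beta>, since \<alpha> = \<mu>/\<nu>
    and u' is \<nu> times \<open>e_dir\<close>.\<close>
  define j where "j = (\<lambda>s. \<mu> s * bracket (u s) (e_dir s))"
  define K where "K = (\<lambda>t. bracket (p - M t) (u t))"
  have M': "(M has_vector_derivative \<mu> t *\<^sub>R e_dir t) (at t)" for t
    unfolding \<mu>_def by (rule area_evolute_deriv)
  have u': "(u has_vector_derivative \<nu> t *\<^sub>R e_dir t) (at t)" for t
    unfolding \<nu>_def u_def by (rule sym_curve_deriv)
  have \<nu>: "\<nu> t > 0" for t
    using r_pos assms by (simp add: \<nu>_def add_pos_pos)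
  have w: "bracket (u t) (e_dir t) > 0" for t
    unfolding u_def by (rule bracket_sym_curve_e_dir_pos[OF assms])
  have vd: "vderiv M t = \<mu> t *\<^sub>R e_dir t" "vderiv u t = \<nu> t *\<^sub>R e_dir t" for t
    using M' u' by (auto intro: vector_derivative_at)
  have "rel_speed M u t = \<mu> t / \<nu> t" for t
    unfolding rel_speed_def vd
    by (rule the_equality) (use \<nu>[of t] e_dir_neq_0[of t] in \<open>auto simp: field_simps\<close>)
  then have "rel_speed M u s * bracket (u s) (vderiv u s) = j s" for s
    using \<nu>[of s] by (simp add: vd j_def bracket.scaleR_right)
  then have coeff: "involute_coeff M u \<theta> = (1/2) * integral {\<theta>..\<theta> + pi} j"
    by (simp add: involute_coeff_def)
  \<comment> \<open>The positive factor \<nu> cancels in v = u'/[u,u'].\<close>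
  have p: "p - M \<theta> = (involute_coeff M u \<theta> / bracket (u \<theta>) (e_dir \<theta>)) *\<^sub>R e_dir \<theta>"
    using \<nu>[of \<theta>] by (simp add: p_def v_involute_def dual_curve_def vd bracket.scaleR_right)
  have side0: "side p \<theta> = 0"
    by (simp add: side_def p bracket.scaleR_left)
  have K0: "K \<theta> = - involute_coeff M u \<theta>"
    using w[of \<theta>] bracket_commute[of "e_dir \<theta>" "u \<theta>"] by (simp add: K_def p bracket.scaleR_left)
  have Kpi: "K (\<theta> + pi) = - K \<theta>"
    by (simp add: K_def u_def bracket.minus_right)
  have K': "(K has_real_derivative \<nu> t * side p t + j t) (at t within S)" for t S
  proof -
    have "((\<lambda>t. p - M t) has_vector_derivative 0 - \<mu> t *\<^sub>R e_dir t) (at t)"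
      by (intro has_vector_derivative_diff has_vector_derivative_const M')
    from has_real_derivative_bracket[OF this u'] bracket_commute[of "e_dir t" "u t"] show ?thesis
      unfolding K_def
      by - (rule has_field_derivative_at_within, simp add: bracket.scaleR_left bracket.scaleR_right bracket.minus_left side_def j_def)
  qed
  have "continuous_on UNIV (\<lambda>t. r (t + pi))"
    by (rule continuous_on_compose2[OF continuous_r]) (auto intro!: continuous_intros)
  moreover have "continuous_on UNIV u"
    by (intro continuous_at_imp_continuous_on ballI has_vector_derivative_continuous[OF u'])
  moreover have "continuous_on UNIV e_dir"
    by (intro continuous_at_imp_continuous_on ballI
        has_vector_derivative_continuous[OF e_dir_has_vector_derivative])
  ultimately have j: "continuous_on UNIV j"
    unfolding j_def \<mu>_def using continuous_r
    by (intro continuous_intros bracket.continuous_on) auto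
  \<comment> \<open>\<open>K\<close> changes sign over a half turn and starts at -\<beta>, so it
    grows by 2\<beta>, exactly the integral of \<open>j\<close>. Thus \<open>I\<close> has equal end
    values, and Rolle yields an interior zero of its derivative
    \<open>\<nu> t * side p t\<close>.\<close>
  define I where "I = (\<lambda>t. K t - integral {\<theta>..t} j)"
  have I': "(I has_real_derivative \<nu> t * side p t) (at t within {\<theta>..\<theta> + pi})"
    if "t \<in> {\<theta>..\<theta> + pi}" for t
    using DERIV_diff[OF K'[of t] integral_has_real_derivative[OF continuous_on_subset[OF j] that]]
    unfolding I_def by simp
  have "I (\<theta> + pi) = I \<theta>"
    using K0 Kpi coeff by (simp add: I_def)
  moreover have "continuous_on {\<theta>..\<theta> + pi} I"
    by (rule DERIV_continuous_on[OF I'])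
  moreover have "(I has_derivative (*) (\<nu> t * side p t)) (at t)" if "\<theta> < t" "t < \<theta> + pi" for t
    using I'[of t] that by (simp add: has_field_derivative_def at_within_Icc_at)
  ultimately have "\<exists>\<xi>>\<theta>. \<xi> < \<theta> + pi \<and> (*) (\<nu> \<xi> * side p \<xi>) = (\<lambda>v. 0)"
    by (intro Rolle_deriv[of \<theta> "\<theta> + pi" I "\<lambda>t. (*) (\<nu> t * side p t)"]) simp_all
  then obtain \<xi> where \<xi>: "\<theta> < \<xi>" "\<xi> < \<theta> + pi" "(*) (\<nu> \<xi> * side p \<xi>) = (\<lambda>v. 0)"
    by blast
  then have "side p \<xi> = 0"
    using fun_cong[OF \<xi>(3), of 1] \<nu>[of \<xi>] by (metis less_irrefl mult.right_neutral mult_eq_0_iff)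
  with side0 \<xi>(1,2) show ?thesis
    unfolding multi_tangent_def p_def u_def by blast
qed

end

section \<open>Application to the given smooth curve\<close>

theorem proposition4p2:
  fixes \<gamma> :: "real \<Rightarrow> real^2" and k :: real
  assumes smooth: "smooth_curve \<gamma>"
    and closed: "\<And>\<theta>. \<gamma> (\<theta> + 2 * pi) = \<gamma> \<theta>"
    and param: "\<And>\<theta>. \<exists>r>0. vderiv \<gamma> \<theta> = r *\<^sub>R e_dir \<theta>"
    and curvature: "\<And>\<theta>. curvature \<gamma> \<theta> > 0"
    and simple: "inj_on \<gamma> {0..<2 * pi}"
    and convex: "convex (inside (range \<gamma>))"
    and k: "k > 0"
  shows "\<forall>\<theta>. v_involute (area_evolute \<gamma>) (sym_curve k \<gamma>) \<theta>
            \<in> region_bounded_by \<gamma> (area_evolute \<gamma>)"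
proof -
  \<comment> \<open>Pairing with the normal recovers the pointwise factor from \<open>param\<close>
    as an explicit function, whose continuity follows from that of \<gamma>'.\<close>
  define r where "r = (\<lambda>\<theta>. bracket (n_dir \<theta>) (vderiv \<gamma> \<theta>))"
  have r: "r \<theta> > 0 \<and> vderiv \<gamma> \<theta> = r \<theta> *\<^sub>R e_dir \<theta>" for \<theta>
    using param[of \<theta>] by (auto simp: r_def bracket.scaleR_right bracket_n_dir_e_dir)
  have diff: "(vderiv ^^ n) \<gamma> differentiable (at t)" for n t
    using smooth unfolding smooth_curve_def by blast
  have "continuous_on UNIV (vderiv \<gamma>)"
    using diff[of 1] by (auto intro!: continuous_at_imp_continuous_on differentiable_imp_continuous_within)
  then have "continuous_on UNIV r"
    unfolding r_def by (intro bracket.continuous_on continuous_on_n_dir)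
  then interpret tangent_angle_curve \<gamma> r
  proof unfold_locales
    show "(\<gamma> has_vector_derivative r \<theta> *\<^sub>R e_dir \<theta>) (at \<theta>)" for \<theta>
      using diff[of 0 \<theta>] r[of \<theta>] by (simp add: vector_derivative_works)
  qed (use r closed in auto)
  show ?thesis
    using multi_tangent_in_region v_involute_multi_tangent[OF k] by blast
qed

end
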